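(* Let $k\ge 1$ and $s_1,\dots,s_k\in\mathbb{N}$ with $s_i\ge 3$ for all $i$. Then $$m(s_1,\dots,s_k)\le \prod_{j=0}^{\max_i s_i-3}\left\lceil \frac{\frac{R(s_1,\dots,s_k)-2}{k}-j}{\min_t s_t-2}\right\rceil.$$
   Context: $K_n$ denotes the complete graph on $n$ vertices. For $s_1,\dots,s_k\in\mathbb{N}$, the Ramsey number $R(s_1,\dots,s_k)$ is the smallest $n$ such that every coloring of the edges of $K_n$ with colors $\{1,\dots,k\}$ contains, for some $i$, a subgraph isomorphic to $K_{s_i}$ all of whose edges have color $i$ (a "monochromatic $K_{s_i}$ in color $i$"). The critical multiplicity $m(s_1,\dots,s_k)$ is the largest number $M$ such that every coloring of the edges of $K_{R(s_1,\dots,s_k)}$ with colors $\{1,\dots,k\}$ contains at least $M$ subgraphs each of which, for some $i\in\{1,\dots,k\}$, is isomorphic to $K_{s_i}$ and monochromatic in color $i$. *)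

theory Defs
  imports Complex_Main "HOL-Library.Ramsey"
begin

text \<open>
  The vertices of the complete graph on \<open>n\<close> vertices are \<open>{..<n}\<close>, its edges are \<open>nsets {..<n} 2\<close>.
  The parameters \<open>s\<^sub>1, \<dots>, s\<^sub>k\<close> form a list \<open>ss\<close> of length \<open>k\<close>, and the colors are
  \<open>{..<length ss}\<close>, so that color \<open>i\<close> belongs to the entry \<open>ss ! i\<close>.
\<close>

definition ramsey_number :: "nat list \<Rightarrow> nat"
  where "ramsey_number ss = (LEAST n. partn_lst {..<n} ss 2)"

text \<open>
  A complete subgraph is identified with its vertex set. Being a set of vertex sets, this
  counts each subgraph once.
\<close>

definition mono_cliques :: "'a set \<Rightarrow> nat list \<Rightarrow> ('a set \<Rightarrow> nat) \<Rightarrow> 'a set set"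
  where "mono_cliques V ss f = {H. \<exists>i<length ss. H \<in> nsets V (ss ! i) \<and> f ` nsets H 2 \<subseteq> {i}}"

definition critical_multiplicity :: "nat list \<Rightarrow> nat"
  where "critical_multiplicity ss =
    (GREATEST M. \<forall>f \<in> nsets {..<ramsey_number ss} 2 \<rightarrow> {..<length ss}.
       M \<le> card (mono_cliques {..<ramsey_number ss} ss f))"

end

theory Submission
  imports Defs
begin

text \<open>
  Take a coloring of the complete graph on \<open>R - 1\<close> vertices without forbidden cliques, and a vertex
  \<open>v\<close>; some color \<open>c\<close> has degree at most \<open>(R - 2) / k\<close> at \<open>v\<close>. Add a twin of \<open>v\<close>, joined to \<open>v\<close> in color
  \<open>c\<close>. A monochromatic clique of forbidden size must contain both twins, so it has color \<open>c\<close> and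
  corresponds to a clique on \<open>s\<^sub>c - 2\<close> vertices in the \<open>c\<close>-neighbourhood of \<open>v\<close>. This neighbourhood has
  no \<open>c\<close>-clique on \<open>s\<^sub>c - 1\<close> vertices, so Zykov's generalization of Turan's theorem bounds their number
  by the product up to \<open>s\<^sub>c - 3\<close>. The remaining factors are at least 1 since \<open>R > k (max s - 1)\<close>.
\<close>

section \<open>Cliques in a graph given by its edge set\<close>

text \<open>The edge set need not live on \<open>V\<close>, so a color class, as a preimage under
  the coloring, serves as \<open>E\<close> directly.\<close>

definition cliques :: "'a set set \<Rightarrow> 'a set \<Rightarrow> nat \<Rightarrow> 'a set set"
  where "cliques E V r = {K \<in> nsets V r. clique K E}"

lemma finite_cliques: "finite V \<Longrightarrow> finite (cliques E V r)"
  unfolding cliques_def by (simp add: finite_imp_finite_nsets)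

lemma mono_iff_clique: "f ` nsets H 2 \<subseteq> {i} \<longleftrightarrow> clique H (f -` {i})"
  unfolding nsets_2_eq clique_def by auto

lemma insert_in_cliques:
  assumes "K \<in> cliques E {u \<in> V. u \<noteq> v \<and> {u, v} \<in> E} r" "v \<in> V"
  shows "insert v K \<in> cliques E V (Suc r)"
  using assms unfolding cliques_def nsets_def clique_def
  by (auto simp: card_insert_if insert_commute)

lemma remove_in_cliques:
  assumes "K \<in> cliques E V (Suc r)" "v \<in> K"
  shows "K - {v} \<in> cliques E {u \<in> V. u \<noteq> v \<and> {u, v} \<in> E} r"
  using assms unfolding cliques_def nsets_def clique_def by auto

section \<open>Zykov's bound on the number of cliques\<close>

text \<open>
  The exponential through the points \<open>(q, q)\<close> and \<open>(q + 1, q + 1)\<close> lies above the diagonal at all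
  integers. Multiplied over several \<open>a\<close>, this says that a product with given sum is largest when
  balanced.
\<close>

lemma mult_power_balance:
  fixes a q :: nat
  assumes "q \<ge> 1"
  shows "real a * (1 + 1 / real q) ^ q \<le> real q * (1 + 1 / real q) ^ a"
proof (cases "a \<ge> q")
  case True
  then obtain d where d: "a = q + d" using le_Suc_ex by blast
  have "1 + real d * (1 / real q) \<le> (1 + 1 / real q) ^ d"
    by (rule Bernoulli_inequality) (simp add: order_trans[of _ 0])
  then have "real q * (1 + real d * (1 / real q)) \<le> real q * (1 + 1 / real q) ^ d"
    by (rule mult_left_mono) simp
  then have "real a \<le> real q * (1 + 1 / real q) ^ d"
    using assms by (simp add: d distrib_left)
  then have "real a * (1 + 1 / real q) ^ q \<le> (real q * (1 + 1 / real q) ^ d) * (1 + 1 / real q) ^ q"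
    by (rule mult_right_mono) simp
  then show ?thesis by (simp add: d power_add mult_ac)
next
  case False
  then obtain d where d: "q = a + d" using le_Suc_ex nat_le_linear by blast
  let ?c = "1 + 1 / real q"
  \<comment> \<open>The exponent a - q = -d is negative, so Bernoulli is applied to the inverse base
    1 - 1 / (q + 1).\<close>
  have inv: "(1 + - 1 / (real q + 1)) * ?c = 1"
  proof -
    have "real q > 0" "real q + 1 > 0" using assms by auto
    then show ?thesis by (simp add: divide_simps)
  qed
  have "real a \<le> real q * (1 + real d * (- 1 / (real q + 1)))"
    using d by (simp add: field_simps)
  also have "\<dots> \<le> real q * (1 + - 1 / (real q + 1)) ^ d"
    by (intro mult_left_mono Bernoulli_inequality) (auto simp: field_simps)
  finally have "real a * ?c ^ d \<le> real q * (1 + - 1 / (real q + 1)) ^ d * ?c ^ d"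
    by (rule mult_right_mono) simp
  also have "\<dots> = real q"
    by (simp only: mult.assoc power_mult_distrib[symmetric] inv) simp
  finally have "real a * ?c ^ d * ?c ^ a \<le> real q * ?c ^ a"
    by (rule mult_right_mono) simp
  then show ?thesis by (simp add: d power_add mult_ac)
qed

text \<open>
  Let \<open>v\<close> lie in the maximal number of \<open>r\<close>-cliques. Its neighbourhood contains no \<open>r\<close>-clique, so every
  \<open>r\<close>-clique meets the complement, and counting the \<open>r\<close>-cliques through each vertex of the complement
  reduces the claim to the \<open>(r - 1)\<close>-cliques in the neighbourhood.
\<close>

lemma card_cliques_le_power:
  fixes q :: nat
  assumes "finite V" "q \<ge> 1" "cliques E V (Suc r) = {}"
  shows "real (card (cliques E V r)) * (1 + 1 / real q) ^ (q * r) \<le> real q ^ r * (1 + 1 / real q) ^ card V"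
  using assms(1,3)
proof (induction r arbitrary: V)
  case 0
  have "cliques E V 0 = {{}}" by (auto simp: cliques_def clique_def)
  then show ?case by simp
next
  case (Suc r)
  let ?c = "1 + 1 / real q"
  let ?D = "\<lambda>v. {K \<in> cliques E V (Suc r). v \<in> K}"
  let ?N = "\<lambda>v. {u \<in> V. u \<noteq> v \<and> {u, v} \<in> E}"
  have fin: "finite (cliques E V (Suc r))" by (rule finite_cliques) fact
  show ?case
  proof (cases "V = {}")
    case True
    then show ?thesis by (simp add: cliques_def nsets_empty_iff)
  next
    case False
    obtain v where v: "v \<in> V" "\<And>u. u \<in> V \<Longrightarrow> card (?D u) \<le> card (?D v)"
    proof -
      have "Max ((\<lambda>u. card (?D u)) ` V) \<in> (\<lambda>u. card (?D u)) ` V"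
        using False Suc.prems(1) by (intro Max_in) auto
      then obtain v where "v \<in> V" "card (?D v) = Max ((\<lambda>u. card (?D u)) ` V)" by auto
      then show thesis using Suc.prems(1) by (intro that[of v]) auto
    qed
    have noN: "cliques E (?N v) (Suc r) = {}"
      using insert_in_cliques[OF _ v(1)] Suc.prems(2) by blast
    have finN: "finite (?N v)" using Suc.prems(1) by simp
    have Dv: "card (?D v) \<le> card (cliques E (?N v) r)"
    proof (rule card_inj_on_le[where f = "\<lambda>K. K - {v}"])
      show "inj_on (\<lambda>K. K - {v}) (?D v)" by (rule inj_onI) blast
      show "(\<lambda>K. K - {v}) ` ?D v \<subseteq> cliques E (?N v) r"
        by (intro image_subsetI remove_in_cliques) auto
    qed (rule finite_cliques[OF finN])
    have "cliques E V (Suc r) \<subseteq> (\<Union>u \<in> V - ?N v. ?D u)"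
    proof
      fix K assume K: "K \<in> cliques E V (Suc r)"
      then have "\<not> K \<subseteq> ?N v" using noN by (auto simp: cliques_def nsets_def)
      then show "K \<in> (\<Union>u \<in> V - ?N v. ?D u)"
        using K by (auto simp: cliques_def nsets_def)
    qed
    then have "card (cliques E V (Suc r)) \<le> card (\<Union>u \<in> V - ?N v. ?D u)"
      using Suc.prems(1) fin by (intro card_mono) auto
    also have "\<dots> \<le> (\<Sum>u \<in> V - ?N v. card (?D u))"
      using Suc.prems(1) by (intro card_UN_le) auto
    also have "\<dots> \<le> card (V - ?N v) * card (?D v)"
      using sum_bounded_above[of "V - ?N v" "\<lambda>u. card (?D u)" "card (?D v)"] v(2) by simp
    also have "\<dots> \<le> card (V - ?N v) * card (cliques E (?N v) r)"
      using Dv by simp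
    finally have le: "real (card (cliques E V (Suc r)))
        \<le> real (card (V - ?N v)) * real (card (cliques E (?N v) r))"
      by (simp only: of_nat_le_iff flip: of_nat_mult)
    have cardV: "card V = card (V - ?N v) + card (?N v)"
      using Suc.prems(1) by (subst card_Diff_subset) (auto simp: card_mono)
    have "real (card (cliques E V (Suc r))) * ?c ^ (q * Suc r)
        \<le> (real (card (V - ?N v)) * real (card (cliques E (?N v) r))) * ?c ^ (q * Suc r)"
      using le by (rule mult_right_mono) simp
    \<comment> \<open>One factor \<open>?c ^ q\<close> goes to the complement, where balancing turns
      its size into a power; the rest goes to the induction hypothesis. The exponents then add up to
      \<open>card V\<close>.\<close>
    also have "\<dots> = (real (card (V - ?N v)) * ?c ^ q) * (real (card (cliques E (?N v) r)) * ?c ^ (q * r))"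
      by (simp add: power_add mult_ac)
    also have "\<dots> \<le> (real q * ?c ^ card (V - ?N v)) * (real q ^ r * ?c ^ card (?N v))"
      by (rule mult_mono[OF mult_power_balance[OF assms(2)] Suc.IH[OF finN noN]]) auto
    also have "\<dots> = real q ^ Suc r * ?c ^ card V"
      by (simp add: cardV power_add mult_ac)
    finally show ?thesis .
  qed
qed

text \<open>The ceilings are the part sizes of the Turan graph on q r + s vertices: (s - j) / r lies
  in (0, 1) for j < s and in (-1, 0] for s \<le> j < r.\<close>

lemma prod_ceiling_balanced:
  assumes "s < r"
  shows "(\<Prod>j<r. \<lceil>(real (q * r + s) - real j) / real r\<rceil>) = int ((q + 1) ^ s * q ^ (r - s))"
proof -
  have "\<lceil>(real (q * r + s) - real j) / real r\<rceil> = (if j < s then int q + 1 else int q)" if "j < r" for j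
    using assms that by (auto simp: ceiling_eq_iff field_simps)
  then have "(\<Prod>j<r. \<lceil>(real (q * r + s) - real j) / real r\<rceil>)
      = (\<Prod>j<r. if j < s then int q + 1 else int q)"
    by (intro prod.cong) auto
  also have "\<dots> = (\<Prod>j\<in>{..<s}. int q + 1) * (\<Prod>j\<in>{s..<r}. int q)"
  proof -
    have "{..<r} \<inter> {j. j < s} = {..<s}" "{..<r} \<inter> - {j. j < s} = {s..<r}" using assms by auto
    then show ?thesis by (subst prod.If_cases) auto
  qed
  finally show ?thesis by (simp add: mult.commute add.commute)
qed

text \<open>With q = \<open>card V div r\<close> the exponential is exact at both possible part
  sizes q and q + 1, so nothing is lost: q^r (1 + 1/q)^s = (q + 1)^s q^(r - s).\<close>

lemma card_cliques_le_prod_ceiling: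
  assumes "finite V" "r \<ge> 1" "cliques E V (Suc r) = {}"
  shows "int (card (cliques E V r)) \<le> (\<Prod>j<r. \<lceil>(real (card V) - real j) / real r\<rceil>)"
proof -
  define q s where "q = card V div r" and "s = card V mod r"
  have s: "s < r" and V: "card V = q * r + s" using assms(2) by (auto simp: q_def s_def)
  have "card (cliques E V r) \<le> (q + 1) ^ s * q ^ (r - s)"
  proof (cases "q = 0")
    case True
    then have "cliques E V r = {}"
      using s V assms(1) by (auto simp: cliques_def nsets_eq_empty)
    then show ?thesis by simp
  next
    case False
    let ?c = "1 + 1 / real q"
    have "real (card (cliques E V r)) * ?c ^ (q * r) \<le> (real q ^ r * ?c ^ s) * ?c ^ (q * r)"
      using card_cliques_le_power[OF assms(1) _ assms(3), of q] False
      by (simp add: V power_add mult_ac)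
    then have "real (card (cliques E V r)) \<le> real q ^ r * ?c ^ s"
      by (rule mult_right_le_imp_le) (auto intro!: zero_less_power add_pos_nonneg)
    also have "\<dots> = real q ^ (r - s) * (real q * ?c) ^ s"
      using s by (simp add: power_mult_distrib flip: power_add mult.assoc)
    also have "real q * ?c = real (q + 1)" using False by (simp add: field_simps)
    finally have "real (card (cliques E V r)) \<le> real ((q + 1) ^ s * q ^ (r - s))"
      by (simp add: mult.commute)
    then show ?thesis by (simp only: of_nat_le_iff)
  qed
  then show ?thesis unfolding V prod_ceiling_balanced[OF s] by (simp only: of_nat_le_iff)
qed

section \<open>A lower bound on the Ramsey number\<close>

text \<open>
  Lower bound coloring: \<open>k\<close> blocks of \<open>s\<^sub>i - 1\<close> vertices each, color \<open>i\<close> inside blocks, and between two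
  blocks a color determined by the lower one. In the quotient every color other than \<open>i\<close> is a star,
  hence triangle-free.
\<close>

lemma ramsey_number_gt:
  assumes i: "i < length ss" and all: "\<And>j. j < length ss \<Longrightarrow> ss ! j \<ge> 3"
  shows "length ss * (ss ! i - 1) < ramsey_number ss"
proof -
  define m where "m = ss ! i - 1"
  define b where "b = (\<lambda>u::nat. u div m)"
  \<comment> \<open>Enumerates the colors other than \<open>i\<close>. The lower of two distinct
    blocks has index at most k - 2, so k - 1 colors suffice.\<close>
  define \<sigma> where "\<sigma> = (\<lambda>a. if a < i then a else Suc a)"
  define f where "f = (\<lambda>e::nat set. if b (Min e) = b (Max e) then i else \<sigma> (b (Min e)))"
  have m: "m > 0" using all[OF i] by (simp add: m_def)
  have b_less: "b u < length ss" if "u < length ss * m" for u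
    using that m by (simp add: b_def less_mult_imp_div_less)
  have b_mono: "b u \<le> b w" if "u \<le> w" for u w using that by (simp add: b_def div_le_mono)
  have f: "f {u, w} = (if b u = b w then i else \<sigma> (b u))" if "u < w" for u w
    using that by (simp add: f_def)
  have "\<not> partn_lst {..<length ss * m} ss 2"
  proof
    assume P: "partn_lst {..<length ss * m} ss 2"
    have "f \<in> nsets {..<length ss * m} 2 \<rightarrow> {..<length ss}"
    proof
      fix e assume "e \<in> nsets {..<length ss * m} 2"
      then obtain u w where e: "e = {u, w}" "u < w" "w < length ss * m"
        by (auto simp: ordered_nsets_2_eq)
      have "\<sigma> (b u) < length ss" if "b u \<noteq> b w"
        using b_mono[of u w] b_less[of w] that e by (auto simp: \<sigma>_def)
      then show "f e \<in> {..<length ss}" using e i by (simp add: f)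
    qed
    then obtain c H where c: "c < length ss" and H: "H \<in> nsets {..<length ss * m} (ss ! c)"
      and "f ` nsets H 2 \<subseteq> {c}"
      using P unfolding partn_lst_def monochromatic_def by blast
    then have col: "f {u, w} = c" if "u \<in> H" "w \<in> H" "u \<noteq> w" for u w
      using that by (auto simp: mono_iff_clique clique_def)
    have \<sigma>: "\<sigma> a \<noteq> i" "\<sigma> a = \<sigma> a' \<longleftrightarrow> a = a'" for a a' by (auto simp: \<sigma>_def)
    show False
    proof (cases "c = i")
      case True
      have same: "b u = b w" if "u \<in> H" "w \<in> H" "u < w" for u w
        using col[OF that(1,2)] that(3) \<sigma>(1) by (auto simp: f True split: if_splits)
      \<comment> \<open>All of \<open>H\<close> lies in one block, so residues separate its vertices
        and it has at most m = s_i - 1 of them.\<close>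
      have "inj_on (\<lambda>u. u mod m) H"
      proof (rule inj_onI)
        fix u w assume uw: "u \<in> H" "w \<in> H" "u mod m = w mod m"
        have "u div m = w div m"
          using same[OF uw(1,2)] same[OF uw(2,1)] by (cases u w rule: linorder_cases) (auto simp: b_def)
        then show "u = w" using uw(3) by (metis div_mult_mod_eq)
      qed
      then have "card H \<le> card {..<m}"
        using m by (intro card_inj_on_le) auto
      then show False using H True m by (simp add: nsets_def m_def)
    next
      case False
      have "3 \<le> card H" using H all[OF c] by (simp add: nsets_def)
      then obtain T where "T \<subseteq> H" "card T = 3" "finite T" by (rule obtain_subset_with_card_n)
      then have "T \<in> nsets H 3" by (simp add: nsets_def)
      then obtain u v w where T: "u \<in> H" "v \<in> H" "w \<in> H" "u < v" "v < w"
        by (auto simp: ordered_nsets_3_eq)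
      \<comment> \<open>Each edge takes the color of its lower block; equal colors would put
        \<open>u\<close> and \<open>v\<close> into one block, where the color is
        \<open>i\<close>.\<close>
      have "f {u, v} = c" "f {v, w} = c" using T col by auto
      then have "b u \<noteq> b v" "\<sigma> (b u) = \<sigma> (b v)" using T False by (auto simp: f split: if_splits)
      then show False using \<sigma>(2) by blast
    qed
  qed
  moreover have "partn_lst {..<ramsey_number ss} ss 2"
    unfolding ramsey_number_def by (rule LeastI_ex) (rule ramsey_full)
  ultimately show ?thesis
    using partn_lst_greater_resource not_less unfolding m_def by blast
qed

section \<open>Critical multiplicity and the twin coloring\<close>

text \<open>The defining \<open>GREATEST\<close> is attained: 0 qualifies, and any single coloring
  bounds the candidates.\<close>

lemma critical_multiplicity_le:
  assumes f: "f \<in> nsets {..<ramsey_number ss} 2 \<rightarrow> {..<length ss}"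
  shows "critical_multiplicity ss \<le> card (mono_cliques {..<ramsey_number ss} ss f)"
proof -
  let ?P = "\<lambda>M. \<forall>f \<in> nsets {..<ramsey_number ss} 2 \<rightarrow> {..<length ss}.
       M \<le> card (mono_cliques {..<ramsey_number ss} ss f)"
  have "?P (critical_multiplicity ss)"
    unfolding critical_multiplicity_def
    by (rule GreatestI_nat[where k = 0 and b = "card (mono_cliques {..<ramsey_number ss} ss f)"])
      (use f in auto)
  then show ?thesis using f by blast
qed

lemma mono_cliques_eq: "mono_cliques V ss f = (\<Union>i<length ss. cliques (f -` {i}) V (ss ! i))"
  unfolding mono_cliques_def cliques_def mono_iff_clique by auto

text \<open>The new vertex \<open>n\<close> is the twin of \<open>v\<close>. Removing both twins is
  injective on the monochromatic cliques because all of them contain both.\<close>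

lemma card_mono_cliques_duplicate:
  fixes f :: "nat set \<Rightarrow> nat"
  assumes f: "f \<in> nsets {..<n} 2 \<rightarrow> {..<length ss}"
    and free: "mono_cliques {..<n} ss f = {}"
    and v: "v < n" and c: "c < length ss" "ss ! c \<ge> 2"
  defines "N \<equiv> {u \<in> {..<n}. u \<noteq> v \<and> {u, v} \<in> f -` {c}}"
  shows "\<exists>g \<in> nsets {..<Suc n} 2 \<rightarrow> {..<length ss}.
    card (mono_cliques {..<Suc n} ss g) \<le> card (cliques (f -` {c}) N (ss ! c - 2))"
proof -
  \<comment> \<open>\<open>h\<close> merges the twins; every edge except the one joining them gets
    the color of its image.\<close>
  define h where "h = (\<lambda>u. if u = n then v else u)"
  define g where "g = (\<lambda>e. if e = {v, n} then c else f (h ` e))"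
  have g: "g {u, w} = f {h u, h w}" if "{u, w} \<noteq> {v, n}" for u w
    using that by (simp add: g_def)
  have h: "h u < n" if "u < Suc n" for u using that v by (auto simp: h_def)
  have "g \<in> nsets {..<Suc n} 2 \<rightarrow> {..<length ss}"
  proof
    fix e assume "e \<in> nsets {..<Suc n} 2"
    then obtain u w where e: "e = {u, w}" "u \<noteq> w" "u < Suc n" "w < Suc n"
      by (auto simp: nsets_2_eq)
    show "g e \<in> {..<length ss}"
    proof (cases "e = {v, n}")
      case True
      then show ?thesis using c by (simp add: g_def)
    next
      case False
      then have "h u \<noteq> h w" using e by (auto simp: h_def split: if_splits)
      then have "{h u, h w} \<in> nsets {..<n} 2" using h e by simp
      then show ?thesis using f g False e by auto
    qed
  qed
  moreover have "card (mono_cliques {..<Suc n} ss g) \<le> card (cliques (f -` {c}) N (ss ! c - 2))"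
  proof (rule card_inj_on_le[where f = "\<lambda>H. H - {v, n}"])
    have mono: "v \<in> H \<and> n \<in> H \<and> H - {v, n} \<in> cliques (f -` {c}) N (ss ! c - 2)"
      if "H \<in> mono_cliques {..<Suc n} ss g" for H
    proof -
      obtain i where i: "i < length ss" and H: "H \<subseteq> {..<Suc n}" "finite H" "card H = ss ! i"
        and col: "\<And>u w. u \<in> H \<Longrightarrow> w \<in> H \<Longrightarrow> u \<noteq> w \<Longrightarrow> g {u, w} = i"
      proof -
        obtain i where "i < length ss" "H \<in> cliques (g -` {i}) {..<Suc n} (ss ! i)"
          using \<open>H \<in> mono_cliques {..<Suc n} ss g\<close> unfolding mono_cliques_eq by blast
        then show thesis
          by (intro that[of i]) (simp_all add: cliques_def nsets_def clique_def)
      qed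
      have vn: "v \<in> H \<and> n \<in> H"
      proof (rule ccontr)
        \<comment> \<open>\<open>h\<close> maps a clique missing a twin injectively to a forbidden
          clique of \<open>f\<close>.\<close>
        assume not_both: "\<not> (v \<in> H \<and> n \<in> H)"
        then have inj: "inj_on h H" by (auto simp: inj_on_def h_def)
        have "h ` H \<in> cliques (f -` {i}) {..<n} (ss ! i)"
          unfolding cliques_def nsets_def clique_def
        proof (intro CollectI conjI ballI impI)
          show "h ` H \<subseteq> {..<n}" using H h by auto
          show "finite (h ` H)" using H by simp
          show "card (h ` H) = ss ! i" using H inj by (simp add: card_image)
          fix x y assume "x \<in> h ` H" "y \<in> h ` H" "x \<noteq> y"
          then obtain u w where uw: "u \<in> H" "w \<in> H" "u \<noteq> w" "x = h u" "y = h w" by auto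
          have "{u, w} \<noteq> {v, n}" using uw not_both by auto
          then show "{x, y} \<in> f -` {i}" using g[of u w] col[OF uw(1-3)] uw by simp
        qed
        then show False using free i by (auto simp: mono_cliques_eq)
      qed
      then have "i = c" using col[of v n] v by (simp add: g_def)
      \<comment> \<open>Allowing \<open>w = v\<close> covers both the edges to \<open>v\<close> and
        those inside the neighbourhood.\<close>
      have f_col: "f {u, w} = c" if "u \<in> H - {v, n}" "w \<in> H - {n}" "u \<noteq> w" for u w
      proof -
        have "{u, w} \<noteq> {v, n}" "h u = u" "h w = w" using that by (auto simp: h_def doubleton_eq_iff)
        then show ?thesis using g[of u w] col[of u w] that \<open>i = c\<close> by simp
      qed
      have "card (H - {v, n}) = ss ! c - 2"
        using H vn v \<open>i = c\<close> by (simp add: card_Diff_subset)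
      moreover have "H - {v, n} \<subseteq> N"
      proof
        fix u assume u: "u \<in> H - {v, n}"
        then have "u < n" using H(1) by fastforce
        then show "u \<in> N" using f_col[of u v] u vn v by (auto simp: N_def)
      qed
      ultimately show ?thesis using vn H f_col by (auto simp: cliques_def nsets_def clique_def)
    qed
    show "inj_on (\<lambda>H. H - {v, n}) (mono_cliques {..<Suc n} ss g)"
      by (rule inj_onI) (use mono in blast)
    show "(\<lambda>H. H - {v, n}) ` mono_cliques {..<Suc n} ss g \<subseteq> cliques (f -` {c}) N (ss ! c - 2)"
      using mono by blast
  qed (simp add: finite_cliques N_def)
  ultimately show ?thesis by blast
qed

text \<open>Pigeonhole on the n - 1 edges at \<open>v\<close>; the product form avoids rounding (n -
  1) / k.\<close>

lemma exists_color_of_small_degree: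
  fixes f :: "nat set \<Rightarrow> nat"
  assumes f: "f \<in> nsets {..<n} 2 \<rightarrow> {..<k}" and v: "v < n" and k: "k > 0"
  shows "\<exists>c<k. k * card {u \<in> {..<n}. u \<noteq> v \<and> {u, v} \<in> f -` {c}} \<le> n - 1"
proof (rule ccontr)
  let ?N = "\<lambda>c. {u \<in> {..<n}. u \<noteq> v \<and> {u, v} \<in> f -` {c}}"
  assume "\<not> ?thesis"
  then have "n \<le> k * card (?N c)" if "c < k" for c using that v by force
  then have "(\<Sum>c<k. n) \<le> (\<Sum>c<k. k * card (?N c))" by (intro sum_mono) auto
  then have "n \<le> (\<Sum>c<k. card (?N c))" using k by (simp flip: sum_distrib_left)
  also have "\<dots> = card (\<Union>c<k. ?N c)" by (subst card_UN_disjoint) auto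
  also have "\<dots> \<le> card ({..<n} - {v})" by (intro card_mono) auto
  also have "\<dots> = n - 1" using v by simp
  finally show False using v by simp
qed

section \<open>The upper bound on the critical multiplicity\<close>

theorem theorem3p2:
  fixes k :: nat and ss :: "nat list"
  assumes "k \<ge> 1" and "length ss = k" and "\<forall>i<k. ss ! i \<ge> 3"
  shows "int (critical_multiplicity ss) \<le>
    (\<Prod>j = 0..Max (set ss) - 3.
       \<lceil>((real (ramsey_number ss) - 2) / real k - real j) / (real (Min (set ss)) - 2)\<rceil>)"
proof -
  define x where "x = (real (ramsey_number ss) - 2) / real k"
  define a where "a = Min (set ss)"
  define b where "b = Max (set ss)"
  have ne: "ss \<noteq> []" using assms by auto
  then have ab: "a \<in> set ss" "b \<in> set ss" by (auto simp: a_def b_def)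
  then obtain i where i: "i < k" "ss ! i = b" using assms by (auto simp: in_set_conv_nth)
  have ge3: "t \<ge> 3" if "t \<in> set ss" for t using that assms by (auto simp: in_set_conv_nth)
  then have ab3: "a \<ge> 3" "b \<ge> 3" using ab by auto
  have lower: "k * (b - 1) < ramsey_number ss"
    using ramsey_number_gt[of i ss] i assms by simp
  define n where "n = ramsey_number ss - 1"
  \<comment> \<open>Guarantees that the coloring on R - 1 vertices has a vertex to duplicate, namely
    0.\<close>
  have "k * (b - 1) \<ge> 2" using assms(1) ab3 mult_le_mono[of 1 k 2 "b - 1"] by simp
  then have R: "ramsey_number ss = Suc n" "0 < n" using lower by (auto simp: n_def)
  \<comment> \<open>Keeps the numerators x - j positive up to the last index j = b - 3.\<close>
  have "real k * real (b - 3) < real (ramsey_number ss) - 2"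
  proof -
    have "k * (b - 3) + 2 \<le> k * (b - 1)"
    proof -
      have "b - 1 = (b - 3) + 2" using ab3 by simp
      then have "k * (b - 1) = k * (b - 3) + 2 * k" by (simp add: distrib_left)
      then show ?thesis using assms(1) by simp
    qed
    then have "k * (b - 3) + 2 < ramsey_number ss" using lower by linarith
    then show ?thesis by (simp flip: of_nat_mult)
  qed
  then have x: "real (b - 3) < x"
    using assms(1) by (simp add: x_def field_simps)

  have "\<not> partn_lst {..<n} ss 2"
    unfolding n_def using R not_less_Least[of n "\<lambda>n. partn_lst {..<n} ss 2"]
    by (simp add: ramsey_number_def)
  then obtain f where f: "f \<in> nsets {..<n} 2 \<rightarrow> {..<length ss}"
    and free: "mono_cliques {..<n} ss f = {}"
    unfolding partn_lst_def monochromatic_def mono_cliques_def by blast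
  obtain c where c: "c < k" and deg: "k * card {u \<in> {..<n}. u \<noteq> 0 \<and> {u, 0} \<in> f -` {c}} \<le> n - 1"
    using exists_color_of_small_degree[of f n k 0] f R assms by auto
  define N where "N = {u \<in> {..<n}. u \<noteq> 0 \<and> {u, 0} \<in> f -` {c}}"
  define r where "r = ss ! c - 2"
  have sc: "ss ! c \<in> set ss" using c assms by simp
  then have "a \<le> ss ! c" "ss ! c \<le> b" by (auto simp: a_def b_def)
  then have r: "r \<ge> 1" "a \<le> r + 2" "r + 2 \<le> b" "ss ! c = Suc (Suc r)"
    using ge3[OF sc] by (auto simp: r_def)
  obtain g where g: "g \<in> nsets {..<Suc n} 2 \<rightarrow> {..<length ss}"
    and card_g: "card (mono_cliques {..<Suc n} ss g) \<le> card (cliques (f -` {c}) N r)"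
    using card_mono_cliques_duplicate[OF f free, of 0 c] R c r assms unfolding N_def r_def by auto
  \<comment> \<open>Together with 0, such a clique would have r + 2 = s_c vertices in color
    \<open>c\<close>.\<close>
  have "cliques (f -` {c}) N (Suc r) = {}"
  proof (rule ccontr)
    assume "cliques (f -` {c}) N (Suc r) \<noteq> {}"
    then obtain K where "K \<in> cliques (f -` {c}) N (Suc r)" by blast
    then have "insert 0 K \<in> cliques (f -` {c}) {..<n} (ss ! c)"
      unfolding N_def r(4) using R by (intro insert_in_cliques) auto
    then show False using free c assms(2) unfolding mono_cliques_eq by blast
  qed
  then have turan: "int (card (cliques (f -` {c}) N r)) \<le> (\<Prod>j<r. \<lceil>(real (card N) - real j) / real r\<rceil>)"
    using r by (intro card_cliques_le_prod_ceiling) (auto simp: N_def)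
  have "real k * real (card N) \<le> real (ramsey_number ss) - 2"
  proof -
    have "real (k * card N) \<le> real (n - 1)" using deg by (simp only: of_nat_le_iff N_def)
    then show ?thesis using R by (simp add: of_nat_diff)
  qed
  then have Nx: "real (card N) \<le> x" using assms(1) by (simp add: x_def field_simps)

  let ?T = "\<lambda>j. \<lceil>(x - real j) / (real a - 2)\<rceil>"
  have T_pos: "?T j \<ge> 1" if "j \<le> b - 3" for j
  proof -
    have "(x - real j) / (real a - 2) > 0"
      using that x ab3 by (intro divide_pos_pos) auto
    then show ?thesis by (simp add: one_le_ceiling)
  qed
  have "int (critical_multiplicity ss) \<le> int (card (cliques (f -` {c}) N r))"
    using critical_multiplicity_le[of g ss] g card_g R by simp
  also note turan
  also have "(\<Prod>j<r. \<lceil>(real (card N) - real j) / real r\<rceil>) \<le> (\<Prod>j<r. ?T j)"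
  proof (rule prod_mono, rule conjI)
    fix j assume "j \<in> {..<r}"
    then have j: "j < r" "j \<le> b - 3" using r by auto
    \<comment> \<open>The numerator may be negative but exceeds -r, so the ceiling is still
      nonnegative.\<close>
    then have "-1 < (real (card N) - real j) / real r" by (simp add: field_simps)
    then show "0 \<le> \<lceil>(real (card N) - real j) / real r\<rceil>" by linarith
    have "(real (card N) - real j) / real r \<le> (x - real j) / real r"
      using Nx by (intro divide_right_mono) auto
    \<comment> \<open>Shrinking the denominator from r to a - 2 enlarges the quotient because x - j
      \<ge> 0.\<close>
    also have "\<dots> \<le> (x - real j) / (real a - 2)"
      using x j r ab3 by (intro divide_left_mono) auto
    finally show "\<lceil>(real (card N) - real j) / real r\<rceil> \<le> ?T j" by (rule ceiling_mono)
  qed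
  also have "\<dots> \<le> (\<Prod>j = 0..b - 3. ?T j)"
  proof (rule prod_mono2)
    show "{..<r} \<subseteq> {0..b - 3}" using r by auto
    show "1 \<le> ?T j" if "j \<in> {0..b - 3} - {..<r}" for j using T_pos that by simp
    show "0 \<le> ?T j" if "j \<in> {..<r}" for j
    proof -
      have "1 \<le> ?T j" using that r by (intro T_pos) auto
      then show ?thesis by linarith
    qed
  qed simp
  finally show ?thesis unfolding x_def a_def b_def .
qed

end
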